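(* Let $\ell\ge0$, $v\ge0$, and let $\boldsymbol h_T:[0,\infty)\to\mathbb R^n$ be $v$-Lipschitz. Consider either of the following two cases: (a) (position interception) $\boldsymbol h(\cdot;\boldsymbol u)=\boldsymbol r(\cdot;\boldsymbol u)$, $\rho=\rho_{\mathcal R_{\boldsymbol r}}$, $v_{\max}=1$; (b) (reaching a time-varying velocity) $\boldsymbol h(\cdot;\boldsymbol u)=\boldsymbol v(\cdot;\boldsymbol u)$, $\rho=\rho_{\mathcal R_{\boldsymbol v}}$, $v_{\max}=2$. Define $$\tau_\rho(t,\mathbf h)=\begin{cases}t+\dfrac{\rho(t,\mathbf h)-\ell}{v_{\max}+v},&\rho(t,\mathbf h)>\ell,\\[2mm] t,&\rho(t,\mathbf h)\le\ell.\end{cases}$$ Then the sequence defined by $t_0=0$, $t_i=\tau_\rho(t_{i-1},\boldsymbol h_T(t_{i-1}))$ for $i\ge1$ converges to the minimum interception time $T^*[\boldsymbol h_T]$ (where, if $T^*[\boldsymbol h_T]=+\infty$, this means $t_i\to+\infty$).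
   Context: Let $n\in\mathbb N$, $n\ge1$; $\lVert\cdot\rVert$ is the Euclidean norm. Fix $v_0\in[0,1)$ and $\boldsymbol v_0=(v_0,0,\dots,0)\in\mathbb R^n$. The set of admissible controls $\mathcal A$ consists of measurable functions $\boldsymbol u$ of time $t\ge0$ with values in the closed unit ball of $\mathbb R^n$. For $\boldsymbol u\in\mathcal A$, $\boldsymbol r(\cdot;\boldsymbol u)$ and $\boldsymbol v(\cdot;\boldsymbol u)$ are the absolutely continuous solutions of $\dot{\boldsymbol r}=\boldsymbol v$, $\dot{\boldsymbol v}=\boldsymbol u-\boldsymbol v$ (a.e.) with $\boldsymbol r(0;\boldsymbol u)=\boldsymbol 0$, $\boldsymbol v(0;\boldsymbol u)=\boldsymbol v_0$. Put $\mathcal R_{\boldsymbol r}(t)=\{\boldsymbol r(t;\boldsymbol u):\boldsymbol u\in\mathcal A\}$, $\mathcal R_{\boldsymbol v}(t)=\{\boldsymbol v(t;\boldsymbol u):\boldsymbol u\in\mathcal A\}$, $\rho_{\mathcal R_{\boldsymbol r}}(t,\mathbf h)=\min_{\tilde{\mathbf h}\in\mathcal R_{\boldsymbol r}(t)}\lVert\mathbf h-\tilde{\mathbf h}\rVert$ and $\rho_{\mathcal R_{\boldsymbol v}}(t,\mathbf h)=\min_{\tilde{\mathbf h}\in\mathcal R_{\boldsymbol v}(t)}\lVert\mathbf h-\tilde{\mathbf h}\rVert$. The interception time for control $\boldsymbol u$ with capture radius $\ell$ is $J[\boldsymbol u;\boldsymbol h_T]=\min\{t\ge0:\lVert\boldsymbol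 h(t;\boldsymbol u)-\boldsymbol h_T(t)\rVert\le\ell\}$ (with $\min\emptyset=+\infty$), and the minimum interception time is $T^*[\boldsymbol h_T]=\inf_{\boldsymbol u\in\mathcal A}J[\boldsymbol u;\boldsymbol h_T]$. *)

theory Defs
  imports "HOL-Analysis.Analysis"
begin

definition abs_cont_on_interval :: "(real \<Rightarrow> 'a::euclidean_space) \<Rightarrow> real \<Rightarrow> real \<Rightarrow> bool" where
  "abs_cont_on_interval f a b \<longleftrightarrow>
     (\<forall>\<epsilon>>0. \<exists>\<delta>>0. \<forall>D :: (real \<times> real) set.
        finite D \<and> (\<forall>(s, t)\<in>D. a \<le> s \<and> s < t \<and> t \<le> b) \<and>
        pairwise (\<lambda>(s, t) (s', t'). {s<..<t} \<inter> {s'<..<t'} = {}) D \<and>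
        (\<Sum>(s, t)\<in>D. t - s) < \<delta>
        \<longrightarrow> (\<Sum>(s, t)\<in>D. norm (f t - f s)) < \<epsilon>)"

definition admissible_controls :: "(real \<Rightarrow> 'a::euclidean_space) set" where
  "admissible_controls = {u \<in> borel_measurable (lebesgue_on {0..}). \<forall>t\<ge>0. u t \<in> cball 0 1}"

text \<open>On the unbounded time axis, absolute continuity is required on every compact
  interval \<open>[0, T]\<close>.\<close>

definition is_solution ::
  "'a::euclidean_space \<Rightarrow> (real \<Rightarrow> 'a) \<Rightarrow> (real \<Rightarrow> 'a) \<Rightarrow> (real \<Rightarrow> 'a) \<Rightarrow> bool" where
  "is_solution v\<^sub>i\<^sub>n u r v \<longleftrightarrow>
     (\<forall>T\<ge>0. abs_cont_on_interval r 0 T \<and> abs_cont_on_interval v 0 T) \<and>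
     (AE t in lebesgue_on {0..}. (r has_vector_derivative v t) (at t within {0..})) \<and>
     (AE t in lebesgue_on {0..}. (v has_vector_derivative (u t - v t)) (at t within {0..})) \<and>
     r 0 = 0 \<and> v 0 = v\<^sub>i\<^sub>n"

text \<open>Solutions are unique on \<open>t \<ge> 0\<close> only (values at negative times are unconstrained),
  so the description operator is applied to the value at time \<open>t\<close>, not to the function.\<close>

definition position :: "'a::euclidean_space \<Rightarrow> (real \<Rightarrow> 'a) \<Rightarrow> real \<Rightarrow> 'a" where
  "position v\<^sub>i\<^sub>n u t = (THE x. \<exists>r v. is_solution v\<^sub>i\<^sub>n u r v \<and> x = r t)"

definition velocity :: "'a::euclidean_space \<Rightarrow> (real \<Rightarrow> 'a) \<Rightarrow> real \<Rightarrow> 'a" where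
  "velocity v\<^sub>i\<^sub>n u t = (THE x. \<exists>r v. is_solution v\<^sub>i\<^sub>n u r v \<and> x = v t)"

text \<open>Below, \<open>h\<close> maps a control and a time to the controlled state component,
  i.e. it is \<open>position v\<^sub>i\<^sub>n\<close> or \<open>velocity v\<^sub>i\<^sub>n\<close>.\<close>

definition reachable_set :: "((real \<Rightarrow> 'a::euclidean_space) \<Rightarrow> real \<Rightarrow> 'a) \<Rightarrow> real \<Rightarrow> 'a set" where
  "reachable_set h t = {h u t |u. u \<in> admissible_controls}"

definition reach_dist :: "((real \<Rightarrow> 'a::euclidean_space) \<Rightarrow> real \<Rightarrow> 'a) \<Rightarrow> real \<Rightarrow> 'a \<Rightarrow> real" where
  "reach_dist h t x = (LEAST d. \<exists>y\<in>reachable_set h t. d = norm (x - y))"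

definition interception_time ::
  "((real \<Rightarrow> 'a::euclidean_space) \<Rightarrow> real \<Rightarrow> 'a) \<Rightarrow> real \<Rightarrow> (real \<Rightarrow> 'a) \<Rightarrow> (real \<Rightarrow> 'a) \<Rightarrow> ereal" where
  "interception_time h l u h\<^sub>T =
     (if \<exists>t\<ge>0. norm (h u t - h\<^sub>T t) \<le> l
      then ereal (LEAST t. t \<ge> 0 \<and> norm (h u t - h\<^sub>T t) \<le> l)
      else \<infinity>)"

definition min_interception_time ::
  "((real \<Rightarrow> 'a::euclidean_space) \<Rightarrow> real \<Rightarrow> 'a) \<Rightarrow> real \<Rightarrow> (real \<Rightarrow> 'a) \<Rightarrow> ereal" where
  "min_interception_time h l h\<^sub>T = (INF u\<in>admissible_controls. interception_time h l u h\<^sub>T)"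

definition tau :: "(real \<Rightarrow> 'a::euclidean_space \<Rightarrow> real) \<Rightarrow> real \<Rightarrow> real \<Rightarrow> real \<Rightarrow> real \<Rightarrow> 'a \<Rightarrow> real" where
  "tau \<rho> l v\<^sub>m\<^sub>a\<^sub>x v t x = (if \<rho> t x > l then t + (\<rho> t x - l) / (v\<^sub>m\<^sub>a\<^sub>x + v) else t)"

primrec tau_iter ::
  "(real \<Rightarrow> 'a::euclidean_space \<Rightarrow> real) \<Rightarrow> real \<Rightarrow> real \<Rightarrow> real \<Rightarrow> (real \<Rightarrow> 'a) \<Rightarrow> nat \<Rightarrow> real" where
  "tau_iter \<rho> l v\<^sub>m\<^sub>a\<^sub>x v h\<^sub>T 0 = 0"
| "tau_iter \<rho> l v\<^sub>m\<^sub>a\<^sub>x v h\<^sub>T (Suc i) =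
     tau \<rho> l v\<^sub>m\<^sub>a\<^sub>x v (tau_iter \<rho> l v\<^sub>m\<^sub>a\<^sub>x v h\<^sub>T i) (h\<^sub>T (tau_iter \<rho> l v\<^sub>m\<^sub>a\<^sub>x v h\<^sub>T i))"

end

theory Submission
  imports Defs
begin

text \<open>
The velocity and the position of the controlled point have explicit formulas: \<open>v\<close> is the integral of
the control against the kernel \<open>exp (s - t)\<close> and \<open>r\<close> against \<open>1 - exp (s - t)\<close>, plus the contribution of
the initial velocity. Both kernels are nonnegative on \<open>[0, t]\<close>, so the reachable sets are closed balls
whose radius is the integral of the kernel and whose points are reached by constant controls
(\<open>reachable_set_velocity\<close>, \<open>reachable_set_position\<close>). The distance to such a ball is explicit, and
centre and radius together move with speed at most \<open>vmax\<close>: 1 for positions, because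
\<open>exp (-t) * norm v\<^sub>i\<^sub>n + (1 - exp (-t)) \<le> 1\<close>, and 2 for velocities. Hence along a \<open>v\<close>-Lipschitz target
the distance to the reachable set is Lipschitz with constant \<open>vmax + v\<close>, each step of the iteration
is a safe lower bound for the capture time, and the monotone sequence can only converge to the first
time at which the distance is at most \<open>l\<close> or diverge if there is no such time
(\<open>tau_iter_convergence\<close>). That first time is the minimum interception time
(\<open>min_interception_time_eq\<close>).

The analytic work lies in the meaning of a solution: absolutely continuous functions satisfying the
equations almost everywhere. Existence for a merely measurable control is Lebesgue's
differentiation theorem (\<open>indefinite_integral_has_derivative_ae\<close>), and uniqueness is the fundamental
theorem of calculus for absolutely continuous functions (\<open>abs_cont_has_integral\<close>). Both have short
proofs with the gauge integral.
\<close>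

section \<open>Calculus of absolutely continuous functions\<close>

lemma AE_nonneg_iff:
  "(AE t in lebesgue_on {0::real..}. P t) \<longleftrightarrow> negligible {t\<in>{0..}. \<not> P t}"
proof -
  have "(AE t in lebesgue_on {0::real..}. P t) \<longleftrightarrow> (AE t in lebesgue. t \<in> {0..} \<longrightarrow> P t)"
    by (rule AE_restrict_space_iff) auto
  also have "\<dots> \<longleftrightarrow> negligible {t\<in>{0..}. \<not> P t}"
    by (simp add: eventually_ae_filter_negligible) (meson mem_Collect_eq negligible_subset subsetI atLeast_iff)
  finally show ?thesis .
qed

text \<open>Distinct pieces overlap only in null sets, so their contents add up to the measure of their union.\<close>

lemma sum_content_le_measure:
  fixes p :: "(real \<times> real set) set"
  assumes p: "p tagged_partial_division_of S" and sub: "\<And>x K. (x,K) \<in> p \<Longrightarrow> K \<subseteq> U"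
    and U: "U \<in> lmeasurable"
  shows "(\<Sum>(x,K)\<in>p. measure lborel K) \<le> measure lebesgue U"
proof -
  have div: "(snd ` p) division_of \<Union>(snd ` p)"
    by (rule partial_division_of_tagged_division[OF p])
  have "(\<Sum>(x,K)\<in>p. measure lborel K) = sum (measure lborel) (snd ` p)"
    by (rule sum.over_tagged_division_lemma[OF tagged_partial_division_of_Union_self[OF p]])
       (simp add: content_eq_0_interior)
  also have "\<dots> = measure lebesgue (\<Union>(snd ` p))"
  proof -
    have "measure lebesgue (\<Union>(snd ` p)) = sum (measure lebesgue) (snd ` p)"
    proof (rule measure_negligible_finite_Union)
      show "finite (snd ` p)" using div by (rule division_ofD)
      show "K \<in> lmeasurable" if "K \<in> snd ` p" for K
        using division_ofD(4)[OF div that] by auto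
      show "pairwise (\<lambda>S T. negligible (S \<inter> T)) (snd ` p)"
        unfolding pairwise_def
      proof (intro ballI impI)
        fix K L assume KL: "K \<in> snd ` p" "L \<in> snd ` p" "K \<noteq> L"
        have "convex (K \<inter> L)"
          using division_ofD(4)[OF div KL(1)] division_ofD(4)[OF div KL(2)] by (auto intro!: convex_Int)
        then show "negligible (K \<inter> L)"
          using division_ofD(5)[OF div KL] by (simp add: negligible_convex_interior)
      qed
    qed
    also have "\<dots> = sum (measure lborel) (snd ` p)"
      by (rule sum.cong[OF refl]) (use division_ofD(4)[OF div] in \<open>force simp: measure_completion\<close>)
    finally show ?thesis by simp
  qed
  also have "\<dots> \<le> measure lebesgue U"
    by (rule measure_mono_fmeasurable) (use sub U lmeasurable_division[OF div] in \<open>fastforce+\<close>)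
  finally show ?thesis .
qed

text \<open>The fundamental theorem of calculus for absolutely continuous functions. The gauge integral gives
a direct proof: at a point outside \<open>N\<close> the gauge forces \<open>f\<close> to follow its derivative up to a relative
error \<open>\<eta>\<close>, and at a point of \<open>N\<close> it forces the interval into an open set \<open>U\<close> of small measure. The
intervals of a fine tagged division with tags in \<open>N\<close> then have small total length, so absolute
continuity bounds the total increment of \<open>f\<close> over them.\<close>

lemma abs_cont_has_integral:
  fixes f :: "real \<Rightarrow> 'a::euclidean_space"
  assumes ab: "a \<le> b" and ac: "abs_cont_on_interval f a b" and N: "negligible N"
    and der: "\<And>x. x \<in> {a..b} - N \<Longrightarrow> (f has_vector_derivative g x) (at x within {a..b})"
  shows "(g has_integral (f b - f a)) {a..b}"
proof -
  \<comment> \<open>The integrand may be changed on \<open>N\<close>; the value 0 there leaves only increments of \<open>f\<close> to be bounded.\<close>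
  define g' where "g' x = (if x \<in> N then 0 else g x)" for x
  have "(g' has_integral (f b - f a)) {a..b}"
    unfolding has_integral_real
  proof (intro allI impI)
    fix e :: real assume e: "e > 0"
    define \<eta> where "\<eta> = e / (2 * (b - a + 1))"
    have \<eta>: "\<eta> > 0" "\<eta> * (b - a) < e / 2"
      using e ab by (auto simp: \<eta>_def field_simps)
    have "e / 2 > 0" using e by simp
    with ac obtain \<delta> where \<delta>: "\<delta> > 0" and ac': "\<forall>D :: (real \<times> real) set.
        finite D \<and> (\<forall>(s, t)\<in>D. a \<le> s \<and> s < t \<and> t \<le> b) \<and>
        pairwise (\<lambda>(s, t) (s', t'). {s<..<t} \<inter> {s'<..<t'} = {}) D \<and>
        (\<Sum>(s, t)\<in>D. t - s) < \<delta> \<longrightarrow> (\<Sum>(s, t)\<in>D. norm (f t - f s)) < e / 2"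
      unfolding abs_cont_on_interval_def by blast
    obtain U where U: "open U" "N \<subseteq> U" "U \<in> lmeasurable" "measure lebesgue U < \<delta>"
    proof -
      obtain U where U: "open U" "N \<subseteq> U" "(U - N) \<in> lmeasurable" "emeasure lebesgue (U - N) < ennreal \<delta>"
        using sets_lebesgue_outer_open[OF _ \<delta>] N negligible_imp_sets by metis
      have "measure lebesgue U = measure lebesgue (U - N)"
        by (rule measure_negligible_symdiff[OF U(3)])
           (use U N in \<open>auto intro: negligible_subset\<close>)
      moreover have "U \<in> lmeasurable"
        using U N by (metis Diff_partition fmeasurable.Un negligible_imp_measurable)
      moreover have "measure lebesgue (U - N) < \<delta>"
        using U(3,4) \<delta> by (simp add: emeasure_eq_measure2 ennreal_less_iff)
      ultimately show thesis using U that by simp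
    qed
    have "\<exists>d>0. x \<in> {a..b} - N \<longrightarrow> (\<forall>y\<in>{a..b}. \<bar>y - x\<bar> < d \<longrightarrow>
             norm (f y - f x - (y - x) *\<^sub>R g x) \<le> \<eta> * \<bar>y - x\<bar>)" for x
    proof (cases "x \<in> {a..b} - N")
      case True
      from der[OF True] \<eta>(1) show ?thesis
        unfolding has_vector_derivative_def has_derivative_within_alt real_norm_def by blast
    qed (auto intro: exI[of _ 1])
    then obtain d where d: "\<And>x. d x > 0" "\<And>x y. x \<in> {a..b} - N \<Longrightarrow> y \<in> {a..b} \<Longrightarrow> \<bar>y - x\<bar> < d x \<Longrightarrow>
             norm (f y - f x - (y - x) *\<^sub>R g x) \<le> \<eta> * \<bar>y - x\<bar>"
      by metis
    define \<gamma> where "\<gamma> x = (if x \<in> N then U else ball x (d x))" for x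
    have gauge: "gauge \<gamma>" using U d by (auto simp: gauge_def \<gamma>_def)
    have est: "norm ((\<Sum>(x,K)\<in>p. measure lborel K *\<^sub>R g' x) - (f b - f a)) < e"
      if p: "p tagged_division_of {a..b}" and fine: "\<gamma> fine p" for p
    proof -
      note pD = tagged_division_ofD[OF p]
      have ppart: "p tagged_partial_division_of {a..b}"
        using p by (simp add: tagged_division_of_def)
      have form: "K = {Inf K..Sup K} \<and> Inf K \<le> x \<and> x \<le> Sup K \<and> a \<le> Inf K \<and> Sup K \<le> b
                   \<and> measure lborel K = Sup K - Inf K \<and> K \<subseteq> \<gamma> x" if xK: "(x,K) \<in> p" for x K
      proof -
        obtain c d where K: "K = {c..d}" using pD(4)[OF xK] by auto
        with pD(2,3)[OF xK] fine xK show ?thesis by (auto simp: fine_def)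
      qed
      let ?h = "\<lambda>(x,K). measure lborel K *\<^sub>R g' x - (f (Sup K) - f (Inf K))"
      define p1 where "p1 = {q \<in> p. fst q \<notin> N}"
      define p2 where "p2 = {q \<in> p. fst q \<in> N}"
      have fin: "finite p" "finite p1" "finite p2" and un: "p = p1 \<union> p2" and dj: "p1 \<inter> p2 = {}"
        using pD(1) by (auto simp: p1_def p2_def)
      have "(\<Sum>(x,K)\<in>p. measure lborel K *\<^sub>R g' x) - (f b - f a) = sum ?h p"
        using additive_tagged_division_1[OF ab p, of f]
        by (simp add: sum_subtractf case_prod_unfold)
      also have "norm \<dots> \<le> (\<Sum>q\<in>p. norm (?h q))" by (rule norm_sum)
      also have "\<dots> = (\<Sum>q\<in>p1. norm (?h q)) + (\<Sum>q\<in>p2. norm (?h q))"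
        unfolding un using fin dj by (intro sum.union_disjoint) auto
      also have "\<dots> < e / 2 + e / 2"
      proof (rule add_strict_mono)
        have "(\<Sum>q\<in>p1. norm (?h q)) \<le> (\<Sum>q\<in>p1. \<eta> * (case q of (x,K) \<Rightarrow> measure lborel K))"
        proof (rule sum_mono, clarify)
          fix x K assume q: "(x,K) \<in> p1"
          then have xK: "(x,K) \<in> p" and xN: "x \<notin> N" by (auto simp: p1_def)
          let ?c = "Inf K" and ?d = "Sup K"
          note F = form[OF xK]
          have cK: "measure lborel K = ?d - ?c" using F by blast
          have sub: "K \<subseteq> ball x (d x)" using F xN by (simp add: \<gamma>_def)
          have "?c \<in> K" "?d \<in> K" using F by (metis atLeastAtMost_iff order_trans order_refl)+
          then have near: "\<bar>?c - x\<bar> < d x" "\<bar>?d - x\<bar> < d x"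
            using sub by (auto simp: dist_real_def)
          have x: "x \<in> {a..b} - N" using F xN by auto
          have 1: "norm (f ?c - f x - (?c - x) *\<^sub>R g x) \<le> \<eta> * (x - ?c)"
            using d(2)[OF x _ near(1)] F by auto
          have 2: "norm (f ?d - f x - (?d - x) *\<^sub>R g x) \<le> \<eta> * (?d - x)"
            using d(2)[OF x _ near(2)] F by auto
          have "measure lborel K *\<^sub>R g' x - (f ?d - f ?c)
              = (f ?c - f x - (?c - x) *\<^sub>R g x) - (f ?d - f x - (?d - x) *\<^sub>R g x)"
            unfolding cK using xN by (simp add: g'_def algebra_simps)
          also have "norm \<dots> \<le> \<eta> * (x - ?c) + \<eta> * (?d - x)"
            using norm_triangle_ineq4 1 2 by (smt (verit))
          also have "\<dots> = \<eta> * measure lborel K" unfolding cK by (simp add: algebra_simps)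
          finally show "norm (measure lborel K *\<^sub>R g' x - (f ?d - f ?c)) \<le> \<eta> * measure lborel K" .
        qed
        also have "\<dots> \<le> (\<Sum>q\<in>p. \<eta> * (case q of (x,K) \<Rightarrow> measure lborel K))"
          using \<eta> fin by (intro sum_mono2) (auto simp: p1_def)
        also have "\<dots> = \<eta> * (b - a)"
          using additive_content_tagged_division[of p a b] p ab
          by (simp add: sum_distrib_left[symmetric] case_prod_unfold)
        finally show "(\<Sum>q\<in>p1. norm (?h q)) < e / 2" using \<eta> by linarith
      next
        \<comment> \<open>Absolute continuity speaks of sets of pairs \<open>(s, t)\<close> with \<open>s < t\<close>; removing degenerate intervals makes \<open>\<phi>\<close> injective.\<close>
        define p3 where "p3 = {q \<in> p2. Inf (snd q) < Sup (snd q)}"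
        define \<phi> where "\<phi> = (\<lambda>q :: real \<times> real set. (Inf (snd q), Sup (snd q)))"
        have p3: "p3 \<subseteq> p" "finite p3" and p3N: "\<And>q. q \<in> p3 \<Longrightarrow> fst q \<in> N"
          using fin by (auto simp: p3_def p2_def)
        have dj3: "{Inf K<..<Sup K} \<inter> {Inf K'<..<Sup K'} = {}"
          if "(x,K) \<in> p3" "(x',K') \<in> p3" "(x,K) \<noteq> (x',K')" for x K x' K'
        proof -
          have "interior K \<inter> interior K' = {}" using that pD(5) p3 by blast
          moreover have "interior K = {Inf K<..<Sup K}" "interior K' = {Inf K'<..<Sup K'}"
            using that p3 form by (metis interior_atLeastAtMost_real subsetD)+
          ultimately show ?thesis by simp
        qed
        have inj: "inj_on \<phi> p3"
        proof (rule inj_onI)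
          fix q q' assume q: "q \<in> p3" "q' \<in> p3" "\<phi> q = \<phi> q'"
          obtain x K x' K' where qq: "q = (x,K)" "q' = (x',K')" by fastforce
          have "{Inf K<..<Sup K} \<noteq> {}" using q qq by (auto simp: p3_def)
          then show "q = q'" using dj3[of x K x' K'] q qq by (auto simp: \<phi>_def)
        qed
        have "(\<Sum>q\<in>p2. norm (?h q)) = (\<Sum>q\<in>p3. norm (?h q))"
        proof (rule sum.mono_neutral_right)
          show "\<forall>q\<in>p2 - p3. norm (?h q) = 0"
          proof
            fix q assume q: "q \<in> p2 - p3"
            then obtain x K where qq: "q = (x,K)" "(x,K) \<in> p" "x \<in> N" by (cases q) (auto simp: p2_def)
            then have "Inf K = Sup K" using q form[OF qq(2)] by (auto simp: p3_def)
            then show "norm (?h q) = 0" using qq by (simp add: g'_def)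
          qed
        qed (use fin in \<open>auto simp: p3_def\<close>)
        also have "\<dots> = (\<Sum>q\<in>p3. norm (f (snd (\<phi> q)) - f (fst (\<phi> q))))"
          by (rule sum.cong) (use p3N in \<open>auto simp: g'_def \<phi>_def norm_minus_commute\<close>)
        also have "\<dots> = (\<Sum>(s,t)\<in>\<phi> ` p3. norm (f t - f s))"
          using inj by (simp add: sum.reindex case_prod_unfold)
        also have "\<dots> < e / 2"
        proof (rule mp[OF spec[OF ac']], intro conjI)
          show "finite (\<phi> ` p3)" using p3 by simp
          show "\<forall>(s, t)\<in>\<phi> ` p3. a \<le> s \<and> s < t \<and> t \<le> b"
          proof (clarsimp simp: \<phi>_def)
            fix x K assume q: "(x,K) \<in> p3"
            with form[of x K] p3 show "a \<le> Inf K \<and> Inf K < Sup K \<and> Sup K \<le> b"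
              by (auto simp: p3_def)
          qed
          show "pairwise (\<lambda>(s, t) (s', t'). {s<..<t} \<inter> {s'<..<t'} = {}) (\<phi> ` p3)"
            unfolding pairwise_def \<phi>_def using dj3 by (simp add: case_prod_unfold) (metis prod.collapse)
          have "(\<Sum>(s, t)\<in>\<phi> ` p3. t - s) = (\<Sum>q\<in>p3. Sup (snd q) - Inf (snd q))"
            using inj by (simp add: sum.reindex case_prod_unfold) (simp add: \<phi>_def)
          also have "\<dots> = (\<Sum>(x,K)\<in>p3. measure lborel K)"
            by (rule sum.cong) (use form p3 in \<open>auto simp: case_prod_unfold\<close>)
          also have "\<dots> \<le> measure lebesgue U"
          proof (rule sum_content_le_measure[OF _ _ U(3)])
            show "p3 tagged_partial_division_of {a..b}"
              by (rule tagged_partial_division_subset[OF ppart p3(1)])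
            show "K \<subseteq> U" if "(x,K) \<in> p3" for x K
              using form[of x K] that p3N[OF that] p3 by (auto simp: \<gamma>_def)
          qed
          also have "\<dots> < \<delta>" by (rule U)
          finally show "(\<Sum>(s, t)\<in>\<phi> ` p3. t - s) < \<delta>" .
        qed
        finally show "(\<Sum>q\<in>p2. norm (?h q)) < e / 2" .
      qed
      finally show ?thesis by simp
    qed
    show "\<exists>\<gamma>. gauge \<gamma> \<and> (\<forall>p. p tagged_division_of {a..b} \<and> \<gamma> fine p \<longrightarrow>
        norm ((\<Sum>(x,K)\<in>p. measure lborel K *\<^sub>R g' x) - (f b - f a)) < e)"
      using gauge est by (intro exI[of _ \<gamma>]) simp
  qed
  then show ?thesis
    by (rule has_integral_spike[OF N, rotated]) (simp add: g'_def)
qed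

section \<open>Differentiation of indefinite integrals\<close>

lemma indefinite_integral_diff:
  fixes f :: "real \<Rightarrow> 'a::euclidean_space"
  assumes f: "f integrable_on {a..b}" and "a \<le> c" "c \<le> d" "d \<le> b"
  shows "integral {a..d} f - integral {a..c} f = integral {c..d} f"
proof -
  have "f integrable_on {a..d}"
    by (rule integrable_on_subinterval[OF f]) (use assms in auto)
  then show ?thesis
    using Henstock_Kurzweil_Integration.integral_combine[of a c d f] assms
    by (simp add: algebra_simps)
qed

text \<open>The core of the Lebesgue differentiation theorem. At a bad point \<open>x\<close> there are arbitrarily short
intervals with end point \<open>x\<close> on which the integral of \<open>f\<close> differs from \<open>f x\<close> times the length by more
than \<open>e\<close> times the length. Vitali's theorem selects disjoint ones covering almost all bad points,
while Henstock's lemma, applied to finitely many of them tagged by \<open>x\<close>, bounds the sum of these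
differences by \<open>e * \<epsilon>\<close>. Hence the total length is at most \<open>\<epsilon>\<close>.\<close>

lemma indefinite_integral_bad_negligible:
  fixes f :: "real \<Rightarrow> 'a::euclidean_space"
  assumes f: "f integrable_on {a..b}" and e: "e > 0"
  defines "F \<equiv> \<lambda>t. integral {a..t} f"
  shows "negligible {x\<in>{a..b}. \<forall>d>0. \<exists>y\<in>{a..b}. \<bar>y - x\<bar> < d \<and>
           e * \<bar>y - x\<bar> < norm (F y - F x - (y - x) *\<^sub>R f x)}" (is "negligible ?S")
  unfolding negligible_outer_le
proof (intro allI impI)
  fix \<epsilon> :: real assume \<epsilon>: "\<epsilon> > 0"
  obtain \<gamma> where \<gamma>: "gauge \<gamma>" and hen: "\<And>p. \<lbrakk>p tagged_partial_division_of cbox a b; \<gamma> fine p\<rbrakk> \<Longrightarrow>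
             sum (\<lambda>(x,K). norm(measure lborel K *\<^sub>R f x - integral K f)) p < e * \<epsilon>"
    using Henstock_lemma[of f a b "e * \<epsilon>"] f e \<epsilon> by auto
  \<comment> \<open>A pair \<open>(x, y)\<close> stands for the closed interval between \<open>x\<close> and \<open>y\<close>, written as a ball for the covering theorem.\<close>
  define I where "I = {(x,y). x \<in> {a..b} \<and> y \<in> {a..b} \<and> {min x y..max x y} \<subseteq> \<gamma> x
            \<and> e * \<bar>y - x\<bar> < norm (F y - F x - (y - x) *\<^sub>R f x)}"
  define c where "c = (\<lambda>(x,y). (x + y) / 2 :: real)"
  define r where "r = (\<lambda>(x,y). \<bar>y - x\<bar> / 2 :: real)"
  have cb: "cball (c i) (r i) = {min (fst i) (snd i)..max (fst i) (snd i)}" for i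
    by (cases i) (auto simp: c_def r_def cball_eq_atLeastAtMost field_simps min_def max_def abs_if)
  have rpos: "0 < r i" if "i \<in> I" for i
    using that by (cases i; cases "fst i = snd i") (auto simp: I_def r_def)
  have cover: "\<exists>i. i \<in> I \<and> x \<in> cball (c i) (r i) \<and> r i < d" if x: "x \<in> ?S" and d: "0 < d" for x d
  proof -
    have "open (\<gamma> x)" "x \<in> \<gamma> x" using \<gamma> by (auto simp: gauge_def)
    then obtain \<rho> where \<rho>: "\<rho> > 0" "ball x \<rho> \<subseteq> \<gamma> x" by (meson open_contains_ball)
    have "min d \<rho> > 0" using d \<rho> by simp
    with x obtain y where y: "y \<in> {a..b}" "\<bar>y - x\<bar> < min d \<rho>"
        "e * \<bar>y - x\<bar> < norm (F y - F x - (y - x) *\<^sub>R f x)" by blast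
    have "{min x y..max x y} \<subseteq> ball x \<rho>"
      using y(2) by (auto simp: dist_real_def abs_if min_def max_def split: if_splits)
    then have "(x,y) \<in> I" using x y \<rho> by (auto simp: I_def)
    moreover have "x \<in> cball (c (x,y)) (r (x,y))" unfolding cb by simp
    moreover have "r (x,y) < d" using y(2) d by (simp add: r_def)
    ultimately show ?thesis by blast
  qed
  obtain C where C: "countable C" "C \<subseteq> I"
     "pairwise (\<lambda>i j. disjnt (cball (c i) (r i)) (cball (c j) (r j))) C"
     "negligible (?S - (\<Union>i \<in> C. cball (c i) (r i)))"
    using Vitali_covering_theorem_cballs[of I r ?S c, OF rpos cover] by blast
  have fin_bound: "measure lebesgue (\<Union>i\<in>D. cball (c i) (r i)) \<le> \<epsilon>" if D: "D \<subseteq> C" "finite D" for D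
  proof -
    define p where "p = (\<lambda>i. (fst i, cball (c i) (r i))) ` D"
    have dj: "cball (c i) (r i) \<inter> cball (c j) (r j) = {}" if "i \<in> D" "j \<in> D" "i \<noteq> j" for i j
    proof -
      have "i \<in> C" "j \<in> C" using D that by auto
      with pairwiseD[OF C(3)] that(3) show ?thesis by (simp add: disjnt_def)
    qed
    have inI: "i \<in> I" if "i \<in> D" for i using that D C by blast
    have inj: "inj_on (\<lambda>i. (fst i, cball (c i) (r i))) D"
    proof (rule inj_onI)
      fix i j assume ij: "i \<in> D" "j \<in> D" "(fst i, cball (c i) (r i)) = (fst j, cball (c j) (r j))"
      have "c i \<in> cball (c i) (r i)" using rpos[OF inI[OF ij(1)]] by simp
      moreover have "cball (c j) (r j) = cball (c i) (r i)" using ij(3) by blast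
      ultimately have "cball (c i) (r i) \<inter> cball (c j) (r j) \<noteq> {}" by blast
      then show "i = j" using dj[OF ij(1,2)] by blast
    qed
    have part: "p tagged_partial_division_of cbox a b"
      unfolding tagged_partial_division_of_def
    proof (intro conjI allI impI)
      show "finite p" using D by (simp add: p_def)
    next
      fix x K assume "(x,K) \<in> p"
      then obtain i where i: "i \<in> D" "x = fst i" "K = cball (c i) (r i)" by (auto simp: p_def)
      then have "i \<in> I" using inI by blast
      then have xi: "x \<in> {a..b}" "snd i \<in> {a..b}" using i(2) by (auto simp: I_def)
      have K: "K = {min x (snd i)..max x (snd i)}" using i(2,3) cb by simp
      show "x \<in> K" "K \<subseteq> cbox a b" using xi by (auto simp: K)
      show "\<exists>a b. K = cbox a b" unfolding K box_real(2)[symmetric] by blast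
    next
      fix x1 K1 x2 K2 assume "(x1,K1) \<in> p \<and> (x2,K2) \<in> p \<and> (x1,K1) \<noteq> (x2,K2)"
      then obtain i j where "i \<in> D" "j \<in> D" "i \<noteq> j" "K1 = cball (c i) (r i)" "K2 = cball (c j) (r j)"
        by (auto simp: p_def)
      then have "K1 \<inter> K2 = {}" using dj by blast
      then show "interior K1 \<inter> interior K2 = {}" using interior_subset by blast
    qed
    have fine: "\<gamma> fine p"
      unfolding fine_def
    proof (intro ballI, clarify)
      fix x K y assume "(x,K) \<in> p" and y: "y \<in> K"
      then obtain i where i: "i \<in> D" "x = fst i" "K = cball (c i) (r i)" by (auto simp: p_def)
      with inI[OF i(1)] have "K \<subseteq> \<gamma> x" unfolding cb by (cases i) (simp add: I_def)
      with y show "y \<in> \<gamma> x" by blast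
    qed
    have one: "e * (2 * r i) \<le> norm (measure lborel (cball (c i) (r i)) *\<^sub>R f (fst i)
                                    - integral (cball (c i) (r i)) f)" if "i \<in> D" for i
    proof -
      obtain x y where i: "i = (x,y)" by fastforce
      have xy: "a \<le> x" "x \<le> b" "a \<le> y" "y \<le> b" and big: "e * \<bar>y - x\<bar> < norm (F y - F x - (y - x) *\<^sub>R f x)"
        using inI[OF that] by (auto simp: I_def i)
      have "norm (measure lborel {min x y..max x y} *\<^sub>R f x - integral {min x y..max x y} f)
            = norm (F y - F x - (y - x) *\<^sub>R f x)"
      proof (cases "x \<le> y")
        case True
        then show ?thesis
          using indefinite_integral_diff[OF f, of x y] xy by (simp add: F_def norm_minus_commute)
      next
        case False
        then have "F x - F y = integral {y..x} f"
          using indefinite_integral_diff[OF f, of y x] xy by (simp add: F_def)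
        then have "(F y - F x) - (y - x) *\<^sub>R f x = (x - y) *\<^sub>R f x - integral {y..x} f"
          by (simp add: algebra_simps)
        with False show ?thesis by simp
      qed
      then show ?thesis
        using big unfolding cb by (simp add: i r_def)
    qed
    have "e * (\<Sum>i\<in>D. 2 * r i) \<le> (\<Sum>i\<in>D. norm (measure lborel (cball (c i) (r i)) *\<^sub>R f (fst i)
                                    - integral (cball (c i) (r i)) f))"
      unfolding sum_distrib_left by (rule sum_mono) (rule one)
    also have "\<dots> = (\<Sum>(x,K)\<in>p. norm (measure lborel K *\<^sub>R f x - integral K f))"
      unfolding p_def using inj by (simp add: sum.reindex)
    also have "\<dots> < e * \<epsilon>" by (rule hen[OF part fine])
    finally have "(\<Sum>i\<in>D. 2 * r i) < \<epsilon>" using e by simp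
    moreover have "measure lebesgue (\<Union>i\<in>D. cball (c i) (r i))
                   \<le> (\<Sum>i\<in>D. measure lebesgue (cball (c i) (r i)))"
      by (rule measure_UNION_le) (use D in auto)
    moreover have "(\<Sum>i\<in>D. measure lebesgue (cball (c i) (r i))) = (\<Sum>i\<in>D. 2 * r i)"
    proof (rule sum.cong[OF refl])
      fix i assume "i \<in> D"
      then have "r i > 0" using rpos inI by blast
      then show "measure lebesgue (cball (c i) (r i)) = 2 * r i"
        unfolding cball_eq_atLeastAtMost by simp
    qed
    ultimately show ?thesis by simp
  qed
  let ?T = "(?S - (\<Union>i \<in> C. cball (c i) (r i))) \<union> (\<Union>i \<in> C. cball (c i) (r i))"
  have m: "(\<Union>i \<in> C. cball (c i) (r i)) \<in> lmeasurable" "measure lebesgue (\<Union>i \<in> C. cball (c i) (r i)) \<le> \<epsilon>"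
    using fmeasurable_UN_bound[of C "\<lambda>i. cball (c i) (r i)" lebesgue \<epsilon>]
      measure_UN_bound[of C "\<lambda>i. cball (c i) (r i)" lebesgue \<epsilon>] C(1) fin_bound by auto
  have "?T \<in> lmeasurable" using m(1) C(4) negligible_imp_measurable by blast
  moreover have "measure lebesgue ?T \<le> \<epsilon>"
    using measure_Un_le[OF negligible_imp_sets[OF C(4)] fmeasurableD[OF m(1)]]
      m(2) negligible_imp_measure0[OF C(4)] by linarith
  moreover have "?S \<subseteq> ?T" unfolding Un_Diff_cancel2 by (rule Un_upper1)
  ultimately show "\<exists>T. ?S \<subseteq> T \<and> T \<in> lmeasurable \<and> measure lebesgue T \<le> \<epsilon>"
    by (intro exI[of _ ?T] conjI)
qed

lemma indefinite_integral_has_derivative_ae: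
  fixes f :: "real \<Rightarrow> 'a::euclidean_space"
  assumes f: "f integrable_on {a..b}"
  shows "negligible {x\<in>{a..b}. \<not> ((\<lambda>t. integral {a..t} f) has_vector_derivative f x) (at x within {a..b})}"
    (is "negligible ?N")
proof -
  let ?F = "\<lambda>t. integral {a..t} f"
  let ?S = "\<lambda>e. {x\<in>{a..b}. \<forall>d>0. \<exists>y\<in>{a..b}. \<bar>y - x\<bar> < d \<and>
           e * \<bar>y - x\<bar> < norm (?F y - ?F x - (y - x) *\<^sub>R f x)}"
  \<comment> \<open>A failure of differentiability is witnessed by some relative error, hence by one of the form \<open>1 / (n + 1)\<close>.\<close>
  have "?N \<subseteq> (\<Union>n. ?S (inverse (real (Suc n))))"
  proof
    fix x assume x: "x \<in> ?N"
    then obtain e where e: "e > 0" and bad: "\<forall>d>0. \<exists>y\<in>{a..b}. \<bar>y - x\<bar> < d \<and>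
           e * \<bar>y - x\<bar> < norm (?F y - ?F x - (y - x) *\<^sub>R f x)"
      by (auto simp: has_vector_derivative_def has_derivative_within_alt bounded_linear_scaleR_left not_le)
    obtain n where "inverse (real (Suc n)) < e" using reals_Archimedean[OF e] by blast
    then have "inverse (real (Suc n)) * \<bar>y - x\<bar> \<le> e * \<bar>y - x\<bar>" for y
      by (intro mult_right_mono) auto
    then have "x \<in> ?S (inverse (real (Suc n)))"
      using bad x by (blast intro: le_less_trans)
    then show "x \<in> (\<Union>n. ?S (inverse (real (Suc n))))" by blast
  qed
  moreover have "negligible (\<Union>n. ?S (inverse (real (Suc n))))"
    by (intro negligible_Union_nat indefinite_integral_bad_negligible[OF f]) simp
  ultimately show ?thesis by (rule negligible_subset[rotated])
qed

lemma indefinite_integral_has_derivative_ae_nonneg: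
  fixes f :: "real \<Rightarrow> 'a::euclidean_space"
  assumes f: "\<And>b. f integrable_on {0..b}"
  shows "negligible {x\<in>{0..}. \<not> ((\<lambda>t. integral {0..t} f) has_vector_derivative f x) (at x within {0..})}"
proof (rule negligible_subset)
  let ?N = "\<lambda>b. {x\<in>{0..b}. \<not> ((\<lambda>t. integral {0..t} f) has_vector_derivative f x) (at x within {0..b})}"
  show "negligible (\<Union>n. ?N (real n))"
    by (intro negligible_Union_nat indefinite_integral_has_derivative_ae f)
  show "{x\<in>{0..}. \<not> ((\<lambda>t. integral {0..t} f) has_vector_derivative f x) (at x within {0..})}
        \<subseteq> (\<Union>n. ?N (real n))"
  proof
    fix x assume x: "x \<in> {x\<in>{0..}. \<not> ((\<lambda>t. integral {0..t} f) has_vector_derivative f x) (at x within {0..})}"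
    obtain n where n: "x < real n" using reals_Archimedean2 by blast
    have "at x within {0..} = at x within {0..real n}"
      by (rule at_within_nhd[of _ "{..<real n}"]) (use n in auto)
    with x n have "x \<in> ?N (real n)" by auto
    then show "x \<in> (\<Union>n. ?N (real n))" by blast
  qed
qed

section \<open>Existence and uniqueness of trajectories\<close>

text \<open>The explicit solutions are locally Lipschitz because controls are bounded; this supplies the
absolute continuity demanded of solutions.\<close>

lemma lipschitz_imp_abs_cont:
  fixes f :: "real \<Rightarrow> 'a::euclidean_space"
  assumes lip: "L-lipschitz_on {a..b} f"
  shows "abs_cont_on_interval f a b"
  unfolding abs_cont_on_interval_def
proof (intro allI impI)
  fix e :: real assume e: "e > 0"
  have L: "L \<ge> 0" by (rule lipschitz_on_nonneg[OF lip])
  show "\<exists>\<delta>>0. \<forall>D :: (real \<times> real) set.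
        finite D \<and> (\<forall>(s, t)\<in>D. a \<le> s \<and> s < t \<and> t \<le> b) \<and>
        pairwise (\<lambda>(s, t) (s', t'). {s<..<t} \<inter> {s'<..<t'} = {}) D \<and>
        (\<Sum>(s, t)\<in>D. t - s) < \<delta>
        \<longrightarrow> (\<Sum>(s, t)\<in>D. norm (f t - f s)) < e"
  proof (intro exI[of _ "e / (L + 1)"] conjI allI impI)
    show "e / (L + 1) > 0" using e L by simp
    fix D :: "(real \<times> real) set"
    assume "finite D \<and> (\<forall>(s, t)\<in>D. a \<le> s \<and> s < t \<and> t \<le> b) \<and>
        pairwise (\<lambda>(s, t) (s', t'). {s<..<t} \<inter> {s'<..<t'} = {}) D \<and>
        (\<Sum>(s, t)\<in>D. t - s) < e / (L + 1)"
    then have D: "\<And>s t. (s,t) \<in> D \<Longrightarrow> a \<le> s \<and> s < t \<and> t \<le> b" and sum: "(\<Sum>(s, t)\<in>D. t - s) < e / (L + 1)"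
      by auto
    have "(\<Sum>(s, t)\<in>D. norm (f t - f s)) \<le> (\<Sum>(s, t)\<in>D. (L + 1) * (t - s))"
    proof (rule sum_mono, clarify)
      fix s t assume "(s,t) \<in> D"
      note st = D[OF this]
      then have "norm (f t - f s) \<le> L * (t - s)"
        using lipschitz_onD[OF lip, of t s] by (auto simp: dist_norm)
      also have "\<dots> \<le> (L + 1) * (t - s)" using st by (simp add: algebra_simps)
      finally show "norm (f t - f s) \<le> (L + 1) * (t - s)" .
    qed
    also have "\<dots> = (L + 1) * (\<Sum>(s, t)\<in>D. t - s)" by (simp add: sum_distrib_left case_prod_unfold)
    also have "\<dots> < e" using sum L by (simp add: field_simps)
    finally show "(\<Sum>(s, t)\<in>D. norm (f t - f s)) < e" .
  qed
qed

lemma continuous_on_nonneg: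
  fixes f :: "real \<Rightarrow> 'a::topological_space"
  assumes "\<And>T. 0 \<le> T \<Longrightarrow> continuous_on {0..T} f"
  shows "continuous_on {0..} f"
  unfolding continuous_on_eq_continuous_within
proof
  fix x :: real assume x: "x \<in> {0..}"
  have "at x within {0..} = at x within {0..x + 1}"
    by (rule at_within_nhd[of _ "{..<x + 1}"]) auto
  moreover have "continuous (at x within {0..x + 1}) f"
    using assms[of "x + 1"] x by (simp add: continuous_on_eq_continuous_within)
  ultimately show "continuous (at x within {0..}) f" by simp
qed

lemma exp_minus_diff_le:
  fixes s t :: real
  assumes "0 \<le> s" "s \<le> t"
  shows "exp (-s) - exp (-t) \<le> t - s"
proof -
  have "exp (-s) - exp (-t) = exp (-s) * (1 - exp (-(t - s)))"
    by (simp add: algebra_simps flip: exp_add)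
  also have "\<dots> \<le> 1 * (1 - exp (-(t - s)))" using assms by (intro mult_right_mono) auto
  also have "\<dots> \<le> t - s" using exp_ge_add_one_self[of "-(t - s)"] unfolding mult_1 by linarith
  finally show ?thesis .
qed

lemma weighted_control_integral:
  fixes u :: "real \<Rightarrow> 'a::euclidean_space"
  assumes u: "u \<in> admissible_controls" and a: "0 \<le> a" and w: "continuous_on {a..b} w"
  shows "(\<lambda>s. w s *\<^sub>R u s) integrable_on {a..b}"
    and "norm (integral {a..b} (\<lambda>s. w s *\<^sub>R u s)) \<le> integral {a..b} (\<lambda>s. \<bar>w s\<bar>)"
proof -
  have meas: "u \<in> borel_measurable (lebesgue_on {a..b})"
  proof (rule measurable_restrict_mono)
    show "u \<in> borel_measurable (lebesgue_on {0..})" using u by (simp add: admissible_controls_def)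
  qed (use a in auto)
  have w': "w \<in> borel_measurable (lebesgue_on {a..b})"
    by (rule continuous_imp_measurable_on_sets_lebesgue[OF w]) simp
  have abs: "(\<lambda>s. \<bar>w s\<bar>) integrable_on {a..b}"
    by (intro integrable_continuous_real continuous_intros w)
  have le: "norm (w s *\<^sub>R u s) \<le> \<bar>w s\<bar>" if "s \<in> {a..b}" for s
  proof -
    have "norm (u s) \<le> 1" using u that a by (auto simp: admissible_controls_def)
    then show ?thesis using mult_left_mono[of "norm (u s)" 1 "\<bar>w s\<bar>"] by simp
  qed
  show int: "(\<lambda>s. w s *\<^sub>R u s) integrable_on {a..b}"
    by (rule measurable_bounded_by_integrable_imp_integrable[OF _ abs le])
       (use meas w' in \<open>auto intro!: borel_measurable_scaleR\<close>)
  show "norm (integral {a..b} (\<lambda>s. w s *\<^sub>R u s)) \<le> integral {a..b} (\<lambda>s. \<bar>w s\<bar>)"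
    by (rule Henstock_Kurzweil_Integration.integral_norm_bound_integral[OF int abs le])
qed

text \<open>The variation of constants formula for \<open>v' = u - v\<close>.\<close>

definition ctrl_velocity :: "'a::euclidean_space \<Rightarrow> (real \<Rightarrow> 'a) \<Rightarrow> real \<Rightarrow> 'a" where
  "ctrl_velocity v\<^sub>i\<^sub>n u t = exp (-t) *\<^sub>R (v\<^sub>i\<^sub>n + integral {0..t} (\<lambda>s. exp s *\<^sub>R u s))"

text \<open>Adding \<open>r' = v\<close> and \<open>v' = u - v\<close> gives \<open>(r + v)' = u\<close>; this expresses the position without a double
integral.\<close>

definition ctrl_position :: "'a::euclidean_space \<Rightarrow> (real \<Rightarrow> 'a) \<Rightarrow> real \<Rightarrow> 'a" where
  "ctrl_position v\<^sub>i\<^sub>n u t = v\<^sub>i\<^sub>n - ctrl_velocity v\<^sub>i\<^sub>n u t + integral {0..t} u"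

lemma weighted_control_integral_lipschitz:
  fixes u :: "real \<Rightarrow> 'a::euclidean_space"
  assumes u: "u \<in> admissible_controls" and w: "continuous_on {0..T} w"
    and B: "\<And>s. s \<in> {0..T} \<Longrightarrow> \<bar>w s\<bar> \<le> B" and B0: "0 \<le> B"
  shows "B-lipschitz_on {0..T} (\<lambda>t. integral {0..t} (\<lambda>s. w s *\<^sub>R u s))"
proof -
  let ?I = "\<lambda>t. integral {0..t} (\<lambda>s. w s *\<^sub>R u s)"
  have le: "dist (?I s) (?I t) \<le> B * dist s t" if st: "0 \<le> s" "s \<le> t" "t \<le> T" for s t
  proof -
    have w': "continuous_on {s..t} w" by (rule continuous_on_subset[OF w]) (use st in auto)
    have "dist (?I s) (?I t) = norm (integral {s..t} (\<lambda>s. w s *\<^sub>R u s))"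
      unfolding dist_norm
      using indefinite_integral_diff[OF weighted_control_integral(1)[OF u order_refl w] st]
      by (metis norm_minus_commute)
    also have "\<dots> \<le> integral {s..t} (\<lambda>s. \<bar>w s\<bar>)" by (rule weighted_control_integral(2)[OF u st(1) w'])
    also have "\<dots> \<le> integral {s..t} (\<lambda>s. B)"
      by (rule integral_le) (use st B w' in \<open>auto intro!: integrable_continuous_real continuous_intros\<close>)
    also have "\<dots> = B * dist s t" using st by (simp add: dist_real_def)
    finally show ?thesis .
  qed
  show ?thesis
  proof (rule lipschitz_onI[OF _ B0])
    fix s t assume "s \<in> {0..T}" "t \<in> {0..T}"
    then show "dist (?I s) (?I t) \<le> B * dist s t"
      using le[of s t] le[of t s] by (cases "s \<le> t") (auto simp: dist_commute)
  qed
qed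

lemma control_integral_lipschitz:
  fixes u :: "real \<Rightarrow> 'a::euclidean_space"
  assumes u: "u \<in> admissible_controls"
  shows "1-lipschitz_on {0..T} (\<lambda>t. integral {0..t} u)"
  using weighted_control_integral_lipschitz[OF u, of T "\<lambda>_. 1" 1] by simp

lemma ctrl_velocity_lipschitz:
  fixes u :: "real \<Rightarrow> 'a::euclidean_space"
  assumes u: "u \<in> admissible_controls"
  shows "\<exists>L. L-lipschitz_on {0..T} (ctrl_velocity v\<^sub>i\<^sub>n u)"
proof -
  let ?I = "\<lambda>t. integral {0..t} (\<lambda>s. exp s *\<^sub>R u s)"
  have I: "(exp T)-lipschitz_on {0..T} ?I"
    by (rule weighted_control_integral_lipschitz[OF u]) (auto intro!: continuous_intros)
  then have "bounded (?I ` {0..T})"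
    by (intro compact_imp_bounded compact_continuous_image lipschitz_on_continuous_on[OF I] compact_Icc)
  then obtain M where M: "\<And>t. t \<in> {0..T} \<Longrightarrow> norm (?I t) \<le> M"
    unfolding bounded_iff ball_simps by blast
  let ?v = "ctrl_velocity v\<^sub>i\<^sub>n u"
  let ?L = "norm v\<^sub>i\<^sub>n + \<bar>M\<bar> + exp T"
  have le: "dist (?v s) (?v t) \<le> ?L * dist s t" if st: "0 \<le> s" "s \<le> t" "t \<le> T" for s t
  proof -
    have "?v s - ?v t = (exp (-s) - exp (-t)) *\<^sub>R (v\<^sub>i\<^sub>n + ?I s) + exp (-t) *\<^sub>R (?I s - ?I t)"
      by (simp add: ctrl_velocity_def algebra_simps)
    also have "norm \<dots> \<le> \<bar>exp (-s) - exp (-t)\<bar> * norm (v\<^sub>i\<^sub>n + ?I s) + exp (-t) * norm (?I s - ?I t)"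
      by (rule order_trans[OF norm_triangle_ineq]) simp
    also have "\<dots> \<le> (t - s) * (norm v\<^sub>i\<^sub>n + \<bar>M\<bar>) + 1 * (exp T * (t - s))"
    proof (intro add_mono mult_mono)
      show "\<bar>exp (-s) - exp (-t)\<bar> \<le> t - s" using exp_minus_diff_le[of s t] st by simp
      show "norm (v\<^sub>i\<^sub>n + ?I s) \<le> norm v\<^sub>i\<^sub>n + \<bar>M\<bar>"
        using norm_triangle_ineq[of "v\<^sub>i\<^sub>n" "?I s"] M[of s] st by auto
      show "norm (?I s - ?I t) \<le> exp T * (t - s)"
        using lipschitz_onD[OF I, of s t] st by (simp add: dist_norm)
    qed (use st in auto)
    finally show ?thesis using st by (simp add: dist_norm algebra_simps)
  qed
  have "?L-lipschitz_on {0..T} ?v"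
  proof (rule lipschitz_onI)
    fix s t assume "s \<in> {0..T}" "t \<in> {0..T}"
    then show "dist (?v s) (?v t) \<le> ?L * dist s t"
      using le[of s t] le[of t s] by (cases "s \<le> t") (auto simp: dist_commute)
  qed simp
  then show ?thesis by blast
qed

lemma ctrl_position_lipschitz:
  fixes u :: "real \<Rightarrow> 'a::euclidean_space"
  assumes u: "u \<in> admissible_controls"
  shows "\<exists>L. L-lipschitz_on {0..T} (ctrl_position v\<^sub>i\<^sub>n u)"
proof -
  obtain L where L: "L-lipschitz_on {0..T} (ctrl_velocity v\<^sub>i\<^sub>n u)" using ctrl_velocity_lipschitz[OF u] by blast
  have "(0 + L + 1)-lipschitz_on {0..T} (ctrl_position v\<^sub>i\<^sub>n u)"
    unfolding ctrl_position_def[abs_def]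
    by (intro lipschitz_on_add lipschitz_on_diff L control_integral_lipschitz u lipschitz_on_constant)
  then show ?thesis by blast
qed

lemma ctrl_is_solution:
  fixes u :: "real \<Rightarrow> 'a::euclidean_space"
  assumes u: "u \<in> admissible_controls"
  shows "is_solution v\<^sub>i\<^sub>n u (ctrl_position v\<^sub>i\<^sub>n u) (ctrl_velocity v\<^sub>i\<^sub>n u)"
proof -
  let ?I = "\<lambda>t. integral {0..t} (\<lambda>s. exp s *\<^sub>R u s)" and ?J = "\<lambda>t. integral {0..t} u"
  let ?N1 = "{x\<in>{0..}. \<not> (?I has_vector_derivative exp x *\<^sub>R u x) (at x within {0..})}"
  let ?N2 = "{x\<in>{0..}. \<not> (?J has_vector_derivative u x) (at x within {0..})}"
  have "negligible ?N1"
    by (intro indefinite_integral_has_derivative_ae_nonneg weighted_control_integral(1)[OF u]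
              continuous_intros order_refl)
  moreover have "negligible ?N2"
    by (rule indefinite_integral_has_derivative_ae_nonneg)
       (use weighted_control_integral(1)[OF u order_refl, of _ "\<lambda>_. 1"] in auto)
  ultimately have N: "negligible (?N1 \<union> ?N2)" by (rule negligible_Un)
  have dv: "(ctrl_velocity v\<^sub>i\<^sub>n u has_vector_derivative (u x - ctrl_velocity v\<^sub>i\<^sub>n u x)) (at x within {0..})"
    if x: "x \<in> {0..}" "x \<notin> ?N1 \<union> ?N2" for x
  proof -
    have I: "(?I has_vector_derivative exp x *\<^sub>R u x) (at x within {0..})" using x by blast
    have E: "((\<lambda>t. exp (-t)) has_field_derivative - exp (-x)) (at x within {0..})"
      by (auto intro!: derivative_eq_intros)
    have "((\<lambda>t. exp (-t) *\<^sub>R (v\<^sub>i\<^sub>n + ?I t)) has_vector_derivative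
        (exp (-x) *\<^sub>R (0 + exp x *\<^sub>R u x) + (- exp (-x)) *\<^sub>R (v\<^sub>i\<^sub>n + ?I x))) (at x within {0..})"
      by (intro has_vector_derivative_scaleR[OF E] has_vector_derivative_add has_vector_derivative_const I)
    moreover have "exp (-x) *\<^sub>R (0 + exp x *\<^sub>R u x) + (- exp (-x)) *\<^sub>R (v\<^sub>i\<^sub>n + ?I x)
        = u x - ctrl_velocity v\<^sub>i\<^sub>n u x"
      by (simp add: ctrl_velocity_def flip: exp_add)
    ultimately show ?thesis unfolding ctrl_velocity_def[abs_def] by simp
  qed
  have dr: "(ctrl_position v\<^sub>i\<^sub>n u has_vector_derivative ctrl_velocity v\<^sub>i\<^sub>n u x) (at x within {0..})"
    if x: "x \<in> {0..}" "x \<notin> ?N1 \<union> ?N2" for x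
  proof -
    have J: "(?J has_vector_derivative u x) (at x within {0..})" using x by blast
    have "((\<lambda>t. v\<^sub>i\<^sub>n - ctrl_velocity v\<^sub>i\<^sub>n u t + ?J t) has_vector_derivative
        (0 - (u x - ctrl_velocity v\<^sub>i\<^sub>n u x) + u x)) (at x within {0..})"
      by (intro has_vector_derivative_add has_vector_derivative_diff has_vector_derivative_const J dv x)
    then show ?thesis unfolding ctrl_position_def[abs_def] by simp
  qed
  show ?thesis
    unfolding is_solution_def AE_nonneg_iff
  proof (intro conjI allI impI)
    fix T :: real
    show "abs_cont_on_interval (ctrl_position v\<^sub>i\<^sub>n u) 0 T"
      using ctrl_position_lipschitz[OF u] lipschitz_imp_abs_cont by blast
    show "abs_cont_on_interval (ctrl_velocity v\<^sub>i\<^sub>n u) 0 T"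
      using ctrl_velocity_lipschitz[OF u] lipschitz_imp_abs_cont by blast
  next
    show "negligible {t \<in> {0..}. \<not> (ctrl_position v\<^sub>i\<^sub>n u has_vector_derivative ctrl_velocity v\<^sub>i\<^sub>n u t) (at t within {0..})}"
      by (rule negligible_subset[OF N]) (use dr in auto)
    show "negligible {t \<in> {0..}. \<not> (ctrl_velocity v\<^sub>i\<^sub>n u has_vector_derivative (u t - ctrl_velocity v\<^sub>i\<^sub>n u t)) (at t within {0..})}"
      by (rule negligible_subset[OF N]) (use dv in auto)
  qed (auto simp: ctrl_position_def ctrl_velocity_def)
qed

lemma solution_has_integral:
  assumes sol: "is_solution v\<^sub>i\<^sub>n u r v" and t: "0 \<le> t"
  shows "((\<lambda>s. u s - v s) has_integral (v t - v\<^sub>i\<^sub>n)) {0..t}" "(v has_integral r t) {0..t}"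
proof -
  note S = sol[unfolded is_solution_def AE_nonneg_iff]
  have sub: "(f has_vector_derivative f') (at x within {0..t})"
    if "(f has_vector_derivative f') (at x within {0..})" for f :: "real \<Rightarrow> 'a" and f' x
    using that by (rule has_vector_derivative_within_subset) auto
  have "((\<lambda>s. u s - v s) has_integral (v t - v 0)) {0..t}"
    by (rule abs_cont_has_integral[where N = "{t\<in>{0..}. \<not> (v has_vector_derivative (u t - v t)) (at t within {0..})}"])
       (use S t in \<open>auto intro!: sub\<close>)
  then show "((\<lambda>s. u s - v s) has_integral (v t - v\<^sub>i\<^sub>n)) {0..t}" using S by simp
  have "(v has_integral (r t - r 0)) {0..t}"
    by (rule abs_cont_has_integral[where N = "{t\<in>{0..}. \<not> (r has_vector_derivative v t) (at t within {0..})}"])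
       (use S t in \<open>auto intro!: sub\<close>)
  then show "(v has_integral r t) {0..t}" using S by simp
qed

text \<open>By the integral form of the equation, the difference \<open>w\<close> of two velocities satisfies
\<open>w t = - \<integral>\<^sub>0\<^sup>t w\<close>. So \<open>w\<close> is continuous, hence continuously differentiable, and \<open>w' = -w\<close> holds
everywhere; then \<open>exp t *\<^sub>R w t\<close> is constant.\<close>

lemma solution_unique:
  assumes sol: "is_solution v\<^sub>i\<^sub>n u r v" "is_solution v\<^sub>i\<^sub>n u r' v'" and T: "0 \<le> T"
  shows "v T = v' T" "r T = r' T"
proof -
  define w where "w t = v t - v' t" for t
  have w_int: "((\<lambda>s. - w s) has_integral w t) {0..t}" if "0 \<le> t" for t
  proof -
    have "((\<lambda>s. (u s - v s) - (u s - v' s)) has_integral ((v t - v\<^sub>i\<^sub>n) - (v' t - v\<^sub>i\<^sub>n))) {0..t}"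
      by (intro has_integral_diff solution_has_integral(1)[OF sol(1) that]
                solution_has_integral(1)[OF sol(2) that])
    then show ?thesis by (simp add: w_def)
  qed
  have w_zero: "w t = 0" if t: "0 \<le> t" for t
  proof -
    have w_eq: "w s = integral {0..s} (\<lambda>s. - w s)" if "s \<in> {0..t}" for s
      by (rule integral_unique[symmetric, OF w_int]) (use that in simp)
    have "continuous_on {0..t} (\<lambda>s. integral {0..s} (\<lambda>s. - w s))"
      by (rule indefinite_integral_continuous_1) (use w_int[OF t] in blast)
    then have cont: "continuous_on {0..t} w"
      using w_eq continuous_on_cong by (metis (no_types, lifting))
    have der: "(w has_vector_derivative - w s) (at s within {0..t})" if s: "s \<in> {0..t}" for s
    proof (rule has_vector_derivative_transform[OF s])
      show "((\<lambda>s. integral {0..s} (\<lambda>s. - w s)) has_vector_derivative - w s) (at s within {0..t})"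
        by (rule integral_has_vector_derivative[OF _ s]) (intro continuous_intros cont)
    qed (rule w_eq)
    have "((\<lambda>s. exp s *\<^sub>R w s) has_vector_derivative 0) (at s within {0..t})" if s: "s \<in> {0..t}" for s
    proof -
      have "((\<lambda>s. exp s *\<^sub>R w s) has_vector_derivative (exp s *\<^sub>R (- w s) + exp s *\<^sub>R w s)) (at s within {0..t})"
        by (intro has_vector_derivative_scaleR der s DERIV_exp[THEN DERIV_subset]) simp
      then show ?thesis by simp
    qed
    then obtain c where c: "\<And>s. s \<in> {0..t} \<Longrightarrow> exp s *\<^sub>R w s = c"
      using has_vector_derivative_zero_constant[OF convex_real_interval(5)] by blast
    have "exp t *\<^sub>R w t = exp 0 *\<^sub>R w 0" using c[of t] c[of 0] t by simp
    moreover have "w 0 = 0" using sol by (simp add: w_def is_solution_def)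
    ultimately show ?thesis by simp
  qed
  then show "v T = v' T" using T by (simp add: w_def)
  have "((\<lambda>s. v s - v' s) has_integral (r T - r' T)) {0..T}"
    by (intro has_integral_diff solution_has_integral(2)[OF sol(1) T] solution_has_integral(2)[OF sol(2) T])
  moreover have "((\<lambda>s. v s - v' s) has_integral 0) {0..T}"
    by (rule has_integral_is_0) (use w_zero in \<open>auto simp: w_def\<close>)
  ultimately have "r T - r' T = 0" by (rule has_integral_unique)
  then show "r T = r' T" by simp
qed

lemma velocity_eq:
  assumes u: "u \<in> admissible_controls" and t: "0 \<le> t"
  shows "velocity v\<^sub>i\<^sub>n u t = ctrl_velocity v\<^sub>i\<^sub>n u t"
  unfolding velocity_def
proof (rule the_equality)
  show "\<exists>r v. is_solution v\<^sub>i\<^sub>n u r v \<and> ctrl_velocity v\<^sub>i\<^sub>n u t = v t" using ctrl_is_solution[OF u] by blast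
qed (use solution_unique(1)[OF _ ctrl_is_solution[OF u] t] in blast)

lemma position_eq:
  assumes u: "u \<in> admissible_controls" and t: "0 \<le> t"
  shows "position v\<^sub>i\<^sub>n u t = ctrl_position v\<^sub>i\<^sub>n u t"
  unfolding position_def
proof (rule the_equality)
  show "\<exists>r v. is_solution v\<^sub>i\<^sub>n u r v \<and> ctrl_position v\<^sub>i\<^sub>n u t = r t" using ctrl_is_solution[OF u] by blast
qed (use solution_unique(2)[OF _ ctrl_is_solution[OF u] t] in blast)

lemma continuous_on_velocity:
  assumes u: "u \<in> admissible_controls"
  shows "continuous_on {0..} (velocity v\<^sub>i\<^sub>n u)"
proof -
  have "continuous_on {0..} (ctrl_velocity v\<^sub>i\<^sub>n u)"
    using ctrl_velocity_lipschitz[OF u] lipschitz_on_continuous_on by (intro continuous_on_nonneg) blast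
  then show ?thesis by (rule continuous_on_eq) (simp add: velocity_eq[OF u])
qed

lemma continuous_on_position:
  assumes u: "u \<in> admissible_controls"
  shows "continuous_on {0..} (position v\<^sub>i\<^sub>n u)"
proof -
  have "continuous_on {0..} (ctrl_position v\<^sub>i\<^sub>n u)"
    using ctrl_position_lipschitz[OF u] lipschitz_on_continuous_on by (intro continuous_on_nonneg) blast
  then show ?thesis by (rule continuous_on_eq) (simp add: position_eq[OF u])
qed

section \<open>Reachable sets\<close>

text \<open>Constant controls already fill the ball, so a norm estimate valid for every control determines
the reachable set exactly.\<close>

lemma reachable_set_eq_cballI:
  fixes h :: "(real \<Rightarrow> 'a::euclidean_space) \<Rightarrow> real \<Rightarrow> 'a"
  assumes le: "\<And>u. u \<in> admissible_controls \<Longrightarrow> norm (h u t - c) \<le> R"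
    and const: "\<And>a. norm a \<le> 1 \<Longrightarrow> h (\<lambda>_. a) t = c + R *\<^sub>R a" and R: "0 \<le> R"
  shows "reachable_set h t = cball c R"
proof
  show "reachable_set h t \<subseteq> cball c R"
    using le by (auto simp: reachable_set_def dist_norm norm_minus_commute)
  show "cball c R \<subseteq> reachable_set h t"
  proof
    fix y assume "y \<in> cball c R"
    then have y: "norm (y - c) \<le> R" by (simp add: dist_norm norm_minus_commute)
    \<comment> \<open>If \<open>R = 0\<close> then \<open>y = c\<close>, and \<open>a\<close> is 0 because division by 0 yields 0.\<close>
    define a where "a = (1 / R) *\<^sub>R (y - c)"
    have "norm a = norm (y - c) / R" using R by (simp add: a_def)
    then have "norm a \<le> 1" using y R by (cases "R = 0") (simp_all add: divide_le_eq_1)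
    moreover have "R *\<^sub>R a = y - c" using y by (cases "R = 0") (auto simp: a_def)
    ultimately have "h (\<lambda>_. a) t = y" "(\<lambda>_. a) \<in> admissible_controls"
      using const by (auto simp: admissible_controls_def)
    then show "y \<in> reachable_set h t" by (auto simp: reachable_set_def)
  qed
qed

lemma exp_has_integral: "0 \<le> t \<Longrightarrow> (exp has_integral (exp t - 1)) {0..t::real}"
  using fundamental_theorem_of_calculus[of 0 t exp exp]
  by (auto simp: has_real_derivative_iff_has_vector_derivative[symmetric] intro: DERIV_exp[THEN DERIV_subset])

lemma const_admissible: "norm a \<le> 1 \<Longrightarrow> (\<lambda>_. a) \<in> admissible_controls"
  by (simp add: admissible_controls_def)

lemma ctrl_velocity_const:
  fixes a :: "'a::euclidean_space"
  assumes t: "0 \<le> t"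
  shows "ctrl_velocity v\<^sub>i\<^sub>n (\<lambda>_. a) t = exp (-t) *\<^sub>R v\<^sub>i\<^sub>n + (1 - exp (-t)) *\<^sub>R a"
proof -
  have "integral {0..t} (\<lambda>s. exp s *\<^sub>R a) = (exp t - 1) *\<^sub>R a"
    by (intro integral_unique has_integral_scaleR_left exp_has_integral t)
  then have "ctrl_velocity v\<^sub>i\<^sub>n (\<lambda>_. a) t = exp (-t) *\<^sub>R v\<^sub>i\<^sub>n + (exp (-t) * (exp t - 1)) *\<^sub>R a"
    by (simp add: ctrl_velocity_def scaleR_add_right)
  also have "exp (-t) * (exp t - 1) = 1 - exp (-t)"
    by (simp add: right_diff_distrib flip: exp_add)
  finally show ?thesis .
qed

lemma reachable_set_velocity:
  fixes v\<^sub>i\<^sub>n :: "'a::euclidean_space"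
  assumes t: "0 \<le> t"
  shows "reachable_set (velocity v\<^sub>i\<^sub>n) t = cball (exp (-t) *\<^sub>R v\<^sub>i\<^sub>n) (1 - exp (-t))"
proof (rule reachable_set_eq_cballI)
  fix u :: "real \<Rightarrow> 'a" assume u: "u \<in> admissible_controls"
  have "norm (integral {0..t} (\<lambda>s. exp s *\<^sub>R u s)) \<le> integral {0..t} (\<lambda>s. \<bar>exp s\<bar>)"
    by (rule weighted_control_integral(2)[OF u]) (auto intro!: continuous_intros)
  also have "\<dots> = exp t - 1" using exp_has_integral[OF t] by (simp add: integral_unique)
  finally have "exp (-t) * norm (integral {0..t} (\<lambda>s. exp s *\<^sub>R u s)) \<le> exp (-t) * (exp t - 1)"
    by (rule mult_left_mono) simp
  then show "norm (velocity v\<^sub>i\<^sub>n u t - exp (-t) *\<^sub>R v\<^sub>i\<^sub>n) \<le> 1 - exp (-t)"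
    by (simp add: velocity_eq[OF u t] ctrl_velocity_def algebra_simps flip: exp_add)
next
  fix a :: 'a assume "norm a \<le> 1"
  then show "velocity v\<^sub>i\<^sub>n (\<lambda>_. a) t = exp (-t) *\<^sub>R v\<^sub>i\<^sub>n + (1 - exp (-t)) *\<^sub>R a"
    by (simp add: velocity_eq const_admissible t ctrl_velocity_const)
qed (use t in simp)

lemma reachable_set_position:
  fixes v\<^sub>i\<^sub>n :: "'a::euclidean_space"
  assumes t: "0 \<le> t"
  shows "reachable_set (position v\<^sub>i\<^sub>n) t = cball ((1 - exp (-t)) *\<^sub>R v\<^sub>i\<^sub>n) (t - (1 - exp (-t)))"
proof (rule reachable_set_eq_cballI)
  fix u :: "real \<Rightarrow> 'a" assume u: "u \<in> admissible_controls"
  let ?w = "\<lambda>s. 1 - exp (-t) * exp s"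
  have E: "(\<lambda>s. exp s *\<^sub>R u s) integrable_on {0..t}"
    by (rule weighted_control_integral(1)[OF u]) (auto intro!: continuous_intros)
  have U: "u integrable_on {0..t}"
    using weighted_control_integral(1)[OF u, of 0 t "\<lambda>_. 1"] by simp
  have "((\<lambda>s. u s - exp (-t) *\<^sub>R (exp s *\<^sub>R u s)) has_integral
      (integral {0..t} u - exp (-t) *\<^sub>R integral {0..t} (\<lambda>s. exp s *\<^sub>R u s))) {0..t}"
    by (intro has_integral_diff has_integral_cmul integrable_integral U E)
  \<comment> \<open>The kernel \<open>1 - exp (s - t)\<close> is nonnegative on \<open>{0..t}\<close>, so its integral is the radius.\<close>
  then have eq: "position v\<^sub>i\<^sub>n u t - (1 - exp (-t)) *\<^sub>R v\<^sub>i\<^sub>n = integral {0..t} (\<lambda>s. ?w s *\<^sub>R u s)"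
    by (simp add: position_eq[OF u t] ctrl_position_def ctrl_velocity_def algebra_simps integral_unique)
  have "norm (integral {0..t} (\<lambda>s. ?w s *\<^sub>R u s)) \<le> integral {0..t} (\<lambda>s. \<bar>?w s\<bar>)"
    by (rule weighted_control_integral(2)[OF u]) (auto intro!: continuous_intros)
  also have "\<dots> = integral {0..t} ?w"
    by (rule Henstock_Kurzweil_Integration.integral_cong) (simp flip: exp_add)
  also have "\<dots> = t - exp (-t) * (exp t - 1)"
  proof (rule integral_unique)
    have "((\<lambda>_. 1::real) has_integral t) {0..t}" using has_integral_const_real[of "1::real" 0 t] t by simp
    then show "(?w has_integral t - exp (-t) * (exp t - 1)) {0..t}"
      by (intro has_integral_diff has_integral_mult_right exp_has_integral t)
  qed
  also have "\<dots> = t - (1 - exp (-t))" by (simp add: algebra_simps flip: exp_add)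
  finally show "norm (position v\<^sub>i\<^sub>n u t - (1 - exp (-t)) *\<^sub>R v\<^sub>i\<^sub>n) \<le> t - (1 - exp (-t))"
    unfolding eq .
next
  fix a :: 'a assume "norm a \<le> 1"
  then show "position v\<^sub>i\<^sub>n (\<lambda>_. a) t = (1 - exp (-t)) *\<^sub>R v\<^sub>i\<^sub>n + (t - (1 - exp (-t))) *\<^sub>R a"
    using t by (simp add: position_eq const_admissible ctrl_position_def ctrl_velocity_const algebra_simps)
next
  show "0 \<le> t - (1 - exp (-t))" using exp_minus_diff_le[of 0 t] t by simp
qed

section \<open>Interception times and the iteration\<close>

lemma reach_dist_ball:
  fixes h :: "(real \<Rightarrow> 'a::euclidean_space) \<Rightarrow> real \<Rightarrow> 'a"
  assumes R: "reachable_set h t = cball c R" and "0 \<le> R"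
  shows "reach_dist h t x = max 0 (norm (x - c) - R)"
    and "\<exists>y\<in>reachable_set h t. norm (x - y) = reach_dist h t x"
proof -
  have ex: "\<exists>y\<in>cball c R. max 0 (norm (x - c) - R) = norm (x - y)"
  proof (cases "norm (x - c) \<le> R")
    case True
    then show ?thesis by (intro bexI[of _ x]) (auto simp: dist_norm norm_minus_commute)
  next
    case False
    then have pos: "norm (x - c) > 0" using \<open>0 \<le> R\<close> by linarith
    define s where "s = R / norm (x - c)"
    have s: "0 \<le> s" "s \<le> 1" "s * norm (x - c) = R" using pos False \<open>0 \<le> R\<close> by (auto simp: s_def)
    have "x - (c + s *\<^sub>R (x - c)) = (1 - s) *\<^sub>R (x - c)" by (simp add: algebra_simps)
    then have "norm (x - (c + s *\<^sub>R (x - c))) = (1 - s) * norm (x - c)" using s by simp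
    also have "\<dots> = max 0 (norm (x - c) - R)" using s(3) False by (simp add: algebra_simps)
    finally show ?thesis
      using s by (intro bexI[of _ "c + s *\<^sub>R (x - c)"]) (auto simp: dist_norm)
  qed
  have le: "max 0 (norm (x - c) - R) \<le> norm (x - y)" if "y \<in> cball c R" for y
  proof -
    have "norm (y - c) \<le> R" using that by (simp add: dist_norm norm_minus_commute)
    moreover have "norm (x - c) \<le> norm (x - y) + norm (y - c)"
      using norm_triangle_ineq[of "x - y" "y - c"] by simp
    ultimately show ?thesis by simp
  qed
  show eq: "reach_dist h t x = max 0 (norm (x - c) - R)"
    unfolding reach_dist_def R by (rule Least_equality) (use ex le in auto)
  show "\<exists>y\<in>reachable_set h t. norm (x - y) = reach_dist h t x"
    unfolding eq R using ex by force
qed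

lemma least_of_closed_halfline:
  fixes S :: "real set"
  assumes "closed S" "S \<noteq> {}" and S: "S \<subseteq> {0..}"
  shows "(LEAST t. t \<in> S) \<in> S" "\<And>t. t \<in> S \<Longrightarrow> (LEAST t. t \<in> S) \<le> t"
proof -
  have bdd: "bdd_below S" using S by (meson bdd_below_Ici bdd_below_mono)
  have "Inf S \<in> S" by (rule closed_contains_Inf[OF assms(2) bdd assms(1)])
  moreover have "\<And>t. t \<in> S \<Longrightarrow> Inf S \<le> t" using bdd by (simp add: cInf_lower)
  ultimately have "(LEAST t. t \<in> S) = Inf S" by (intro Least_equality) auto
  with \<open>Inf S \<in> S\<close> \<open>\<And>t. t \<in> S \<Longrightarrow> Inf S \<le> t\<close>
  show "(LEAST t. t \<in> S) \<in> S" "\<And>t. t \<in> S \<Longrightarrow> (LEAST t. t \<in> S) \<le> t" by auto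
qed

text \<open>Some control captures the target at time \<open>t\<close> exactly when the target is within \<open>l\<close> of the reachable
set at time \<open>t\<close>. Trajectories and target are continuous, so each first capture time is attained and
the infimum over controls is the first time in \<open>S\<close>.\<close>

lemma min_interception_time_eq:
  fixes h :: "(real \<Rightarrow> 'a::euclidean_space) \<Rightarrow> real \<Rightarrow> 'a"
  assumes cont: "\<And>u. u \<in> admissible_controls \<Longrightarrow> continuous_on {0..} (h u)"
    and hT: "continuous_on {0..} h\<^sub>T"
    and R: "\<And>t. 0 \<le> t \<Longrightarrow> reachable_set h t = cball (c t) (R t)" "\<And>t. 0 \<le> t \<Longrightarrow> 0 \<le> R t"
    and l: "0 \<le> l"
  defines "S \<equiv> {t\<in>{0..}. reach_dist h t (h\<^sub>T t) \<le> l}"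
  shows "S = {} \<Longrightarrow> min_interception_time h l h\<^sub>T = \<infinity>"
    and "T \<in> S \<Longrightarrow> (\<And>t. t \<in> S \<Longrightarrow> T \<le> t) \<Longrightarrow> min_interception_time h l h\<^sub>T = ereal T"
proof -
  let ?C = "\<lambda>u. {t\<in>{0..}. norm (h u t - h\<^sub>T t) \<le> l}"
  have sub: "?C u \<subseteq> S" if u: "u \<in> admissible_controls" for u
  proof
    fix t assume t: "t \<in> ?C u"
    then have "h u t \<in> cball (c t) (R t)" using R(1)[of t] u by (auto simp: reachable_set_def)
    then have "norm (h u t - c t) \<le> R t" by (simp add: dist_norm norm_minus_commute)
    moreover have "norm (h\<^sub>T t - c t) \<le> norm (h u t - h\<^sub>T t) + norm (h u t - c t)"
      using norm_triangle_ineq[of "h\<^sub>T t - h u t" "h u t - c t"] by (simp add: norm_minus_commute)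
    ultimately show "t \<in> S" using t l R(2)[of t] by (simp add: S_def reach_dist_ball(1)[OF R])
  qed
  have time: "interception_time h l u h\<^sub>T = (if ?C u = {} then \<infinity> else ereal (LEAST t. t \<in> ?C u))" for u
    unfolding interception_time_def by auto
  have closed: "closed (?C u)" if u: "u \<in> admissible_controls" for u
    by (intro continuous_on_closed_Collect_le continuous_intros cont[OF u] hT)
  {
    assume "S = {}"
    then have "interception_time h l u h\<^sub>T = \<infinity>" if "u \<in> admissible_controls" for u
      using sub[OF that] by (simp add: time)
    then show "min_interception_time h l h\<^sub>T = \<infinity>"
      unfolding min_interception_time_def
      by (metis INF_greatest ereal_infty_less_eq(1) order_refl)
  next
    assume T: "T \<in> S" and least: "\<And>t. t \<in> S \<Longrightarrow> T \<le> t"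
    have lower: "ereal T \<le> interception_time h l u h\<^sub>T" if u: "u \<in> admissible_controls" for u
    proof (cases "?C u = {}")
      case False
      have "(LEAST t. t \<in> ?C u) \<in> ?C u"
        by (rule least_of_closed_halfline(1)[OF closed[OF u] False]) auto
      then have "T \<le> (LEAST t. t \<in> ?C u)" using sub[OF u] least by blast
      with False show ?thesis by (simp add: time)
    qed (simp add: time)
    have T0: "0 \<le> T" and TR: "reach_dist h T (h\<^sub>T T) \<le> l"
      using T by (auto simp: S_def)
    obtain u where u: "u \<in> admissible_controls" "norm (h u T - h\<^sub>T T) \<le> l"
      using reach_dist_ball(2)[OF R(1)[OF T0] R(2)[OF T0], of "h\<^sub>T T"] TR
      by (auto simp: reachable_set_def norm_minus_commute)
    then have "T \<in> ?C u" using T0 by auto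
    then have "interception_time h l u h\<^sub>T \<le> ereal T"
      using least_of_closed_halfline(2)[OF closed[OF u(1)], of T] by (auto simp: time)
    with u lower show "min_interception_time h l h\<^sub>T = ereal T"
      unfolding min_interception_time_def
      by (intro antisym INF_greatest) (auto intro: INF_lower2)
  }
qed

text \<open>Let \<open>d t\<close> be the distance of the target from the reachable set at time \<open>t\<close>. By the explicit formula
for the distance to a ball, \<open>speed\<close> makes \<open>d\<close> Lipschitz with constant \<open>K = vmax + v\<close>. So \<open>d\<close> cannot
fall from \<open>d t\<close> to \<open>l\<close> in less than \<open>(d t - l) / K\<close>, and the iteration never passes a capture time.
If it stays bounded, its increments tend to 0 and continuity gives \<open>d \<le> l\<close> at the limit, which is
then the first capture time.\<close>

lemma tau_iter_convergence:
  fixes h :: "(real \<Rightarrow> 'a::euclidean_space) \<Rightarrow> real \<Rightarrow> 'a"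
  assumes cont: "\<And>u. u \<in> admissible_controls \<Longrightarrow> continuous_on {0..} (h u)"
    and R: "\<And>t. 0 \<le> t \<Longrightarrow> reachable_set h t = cball (c t) (R t)" "\<And>t. 0 \<le> t \<Longrightarrow> 0 \<le> R t"
    and speed: "\<And>s t. 0 \<le> s \<Longrightarrow> s \<le> t \<Longrightarrow> norm (c t - c s) + \<bar>R t - R s\<bar> \<le> vmax * (t - s)"
    and vmax: "0 < vmax"
    and l: "0 \<le> l" and v: "0 \<le> v" and lip: "v-lipschitz_on {0..} h\<^sub>T"
  shows "(\<lambda>i. ereal (tau_iter (reach_dist h) l vmax v h\<^sub>T i)) \<longlonglongrightarrow> min_interception_time h l h\<^sub>T"
proof -
  define d where "d t = reach_dist h t (h\<^sub>T t)" for t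
  define K where "K = vmax + v"
  define \<tau> where "\<tau> = tau_iter (reach_dist h) l vmax v h\<^sub>T"
  define S where "S = {t\<in>{0..}. d t \<le> l}"
  have K: "K > 0" using vmax v by (simp add: K_def)
  have d_eq: "d t = max 0 (norm (h\<^sub>T t - c t) - R t)" if "0 \<le> t" for t
    unfolding d_def by (rule reach_dist_ball(1)[OF R]) (use that in auto)
  have d_diff: "\<bar>d t - d s\<bar> \<le> K * (t - s)" if "0 \<le> s" "s \<le> t" for s t
  proof -
    have "norm (h\<^sub>T t - h\<^sub>T s) \<le> v * (t - s)"
      using lipschitz_onD[OF lip, of t s] that by (simp add: dist_norm)
    moreover have "\<bar>norm (h\<^sub>T t - c t) - norm (h\<^sub>T s - c s)\<bar> \<le> norm ((h\<^sub>T t - c t) - (h\<^sub>T s - c s))"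
      by (rule norm_triangle_ineq3)
    moreover have "norm ((h\<^sub>T t - c t) - (h\<^sub>T s - c s)) \<le> norm (h\<^sub>T t - h\<^sub>T s) + norm (c t - c s)"
      using norm_triangle_ineq4[of "h\<^sub>T t - h\<^sub>T s" "c t - c s"] by (simp add: algebra_simps)
    moreover have "K * (t - s) = vmax * (t - s) + v * (t - s)" by (simp add: K_def algebra_simps)
    ultimately show ?thesis using speed[OF that] that by (simp add: d_eq)
  qed
  have "K-lipschitz_on {0..} d"
  proof (rule lipschitz_onI)
    fix s t :: real assume "s \<in> {0..}" "t \<in> {0..}"
    then show "dist (d s) (d t) \<le> K * dist s t"
      using d_diff[of s t] d_diff[of t s] by (cases "s \<le> t") (auto simp: dist_real_def abs_minus_commute)
  qed (use K in simp)
  then have d_cont: "continuous_on {0..} d" by (rule lipschitz_on_continuous_on)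
  have step: "\<tau> (Suc i) = (if d (\<tau> i) > l then \<tau> i + (d (\<tau> i) - l) / K else \<tau> i)" for i
    by (simp add: \<tau>_def d_def K_def tau_def)
  have mono: "incseq \<tau>"
    by (rule incseq_SucI) (use K in \<open>simp add: step\<close>)
  have nonneg: "0 \<le> \<tau> i" for i
    using incseqD[OF mono, of 0 i] by (simp add: \<tau>_def)
  have below: "\<tau> i \<le> t" if t: "t \<in> S" for i t
  proof (induction i)
    case 0
    then show ?case using t by (simp add: \<tau>_def S_def)
  next
    case (Suc i)
    have "d (\<tau> i) - l \<le> K * (t - \<tau> i)"
      using d_diff[OF nonneg Suc] t by (simp add: S_def abs_le_iff)
    then have "(d (\<tau> i) - l) / K \<le> t - \<tau> i" using K by (simp add: field_simps)
    then show ?case using Suc by (simp add: step)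
  qed
  have hT: "continuous_on {0..} h\<^sub>T" by (rule lipschitz_on_continuous_on[OF lip])
  note T_eq = min_interception_time_eq[OF cont hT R l, folded d_def, folded S_def]
  show ?thesis unfolding \<tau>_def[symmetric]
  proof (cases "bdd_above (range \<tau>)")
    case True
    define T where "T = (SUP i. \<tau> i)"
    have lim: "\<tau> \<longlonglongrightarrow> T" unfolding T_def by (rule LIMSEQ_incseq_SUP[OF True mono])
    have T0: "0 \<le> T" by (rule LIMSEQ_le_const[OF lim]) (use nonneg in auto)
    have "(\<lambda>i. d (\<tau> i)) \<longlonglongrightarrow> d T"
      using d_cont lim T0 nonneg by (intro continuous_on_tendsto_compose[OF d_cont lim]) auto
    moreover have "(\<lambda>i. l + K * (\<tau> (Suc i) - \<tau> i)) \<longlonglongrightarrow> l + K * (T - T)"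
      by (intro tendsto_intros LIMSEQ_Suc lim)
    moreover have "d (\<tau> i) \<le> l + K * (\<tau> (Suc i) - \<tau> i)" for i
      using K by (simp add: step)
    ultimately have "d T \<le> l + K * (T - T)" by (intro LIMSEQ_le) auto
    then have "T \<in> S" using T0 by (simp add: S_def)
    moreover have least: "T \<le> t" if "t \<in> S" for t
      by (rule LIMSEQ_le_const2[OF lim]) (use below[OF that] in auto)
    ultimately have "min_interception_time h l h\<^sub>T = ereal T" using T_eq(2) by blast
    then show "(\<lambda>i. ereal (\<tau> i)) \<longlonglongrightarrow> min_interception_time h l h\<^sub>T" using lim by simp
  next
    case False
    then have "S = {}" using below by (meson bdd_above.I2 ex_in_conv)
    then have "min_interception_time h l h\<^sub>T = \<infinity>" using T_eq(1) by blast
    moreover have "filterlim \<tau> at_top sequentially"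
      unfolding filterlim_at_top
    proof
      fix M
      obtain n where "\<tau> n > M" using False by (meson bdd_above.I2 not_le)
      then show "\<forall>\<^sub>F i in sequentially. M \<le> \<tau> i"
        using mono by (intro eventually_sequentiallyI[of n]) (meson incseqD less_imp_le order_trans)
    qed
    ultimately show "(\<lambda>i. ereal (\<tau> i)) \<longlonglongrightarrow> min_interception_time h l h\<^sub>T"
      by (simp add: tendsto_PInfty_eq_at_top)
  qed
qed

theorem mainTheorem3:
  fixes v0 l v :: real and k :: "'n::finite" and h\<^sub>T :: "real \<Rightarrow> real ^ 'n"
  assumes "0 \<le> v0" and "v0 < 1"
    and "l \<ge> 0" and "v \<ge> 0"
    and "v-lipschitz_on {0..} h\<^sub>T"
  shows "((\<lambda>i. ereal (tau_iter (reach_dist (position (axis k v0))) l 1 v h\<^sub>T i))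
           \<longlonglongrightarrow> min_interception_time (position (axis k v0)) l h\<^sub>T)
       \<and> ((\<lambda>i. ereal (tau_iter (reach_dist (velocity (axis k v0))) l 2 v h\<^sub>T i))
           \<longlonglongrightarrow> min_interception_time (velocity (axis k v0)) l h\<^sub>T)"
proof
  let ?v = "axis k v0 :: real ^ 'n"
  have norm_v: "norm ?v \<le> 1"
    using assms(1,2) by (simp add: norm_eq_sqrt_inner inner_axis_axis)
  show "(\<lambda>i. ereal (tau_iter (reach_dist (position ?v)) l 1 v h\<^sub>T i))
           \<longlonglongrightarrow> min_interception_time (position ?v) l h\<^sub>T"
  proof (rule tau_iter_convergence[OF continuous_on_position reachable_set_position])
    fix s t :: real assume st: "0 \<le> s" "s \<le> t"
    have "(1 - exp (-t)) *\<^sub>R ?v - (1 - exp (-s)) *\<^sub>R ?v = (exp (-s) - exp (-t)) *\<^sub>R ?v"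
      by (simp add: algebra_simps)
    then have "norm ((1 - exp (-t)) *\<^sub>R ?v - (1 - exp (-s)) *\<^sub>R ?v) = (exp (-s) - exp (-t)) * norm ?v"
      using st by simp
    also have "\<dots> \<le> exp (-s) - exp (-t)" using norm_v st by (intro mult_left_le) auto
    finally show "norm ((1 - exp (-t)) *\<^sub>R ?v - (1 - exp (-s)) *\<^sub>R ?v)
        + \<bar>(t - (1 - exp (-t))) - (s - (1 - exp (-s)))\<bar> \<le> 1 * (t - s)"
      using exp_minus_diff_le[OF st] by simp
  next
    show "0 \<le> t - (1 - exp (-t))" if "0 \<le> t" for t :: real
      using exp_minus_diff_le[of 0 t] that by simp
  qed (use assms in auto)
  show "(\<lambda>i. ereal (tau_iter (reach_dist (velocity ?v)) l 2 v h\<^sub>T i))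
           \<longlonglongrightarrow> min_interception_time (velocity ?v) l h\<^sub>T"
  proof (rule tau_iter_convergence[OF continuous_on_velocity reachable_set_velocity])
    fix s t :: real assume st: "0 \<le> s" "s \<le> t"
    have "norm (exp (-t) *\<^sub>R ?v - exp (-s) *\<^sub>R ?v) = (exp (-s) - exp (-t)) * norm ?v"
      using st by (simp flip: scaleR_left_diff_distrib)
    also have "\<dots> \<le> exp (-s) - exp (-t)" using norm_v st by (intro mult_left_le) auto
    finally show "norm (exp (-t) *\<^sub>R ?v - exp (-s) *\<^sub>R ?v)
        + \<bar>(1 - exp (-t)) - (1 - exp (-s))\<bar> \<le> 2 * (t - s)"
      using exp_minus_diff_le[OF st] st by simp
  qed (use assms in auto)
qed

end
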